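(* Let $V=V^{(1)}\otimes\cdots\otimes V^{(d)}$ be a tensor product of finite dimensional complex Hilbert spaces, and let $T\in V$ be a tensor that has a diagonal singular value decomposition. If the singular values of $T$ are distinct, then the diagonal singular value decomposition of $T$ is unique; that is, if $T=\sum_{i=1}^r\sigma_iv_i$ is a diagonal singular value decomposition with $\sigma_1>\sigma_2>\cdots>\sigma_r>0$ and $T=\sum_{i=1}^s\lambda_iw_i$ is any diagonal singular value decomposition, then $s=r$, and $\lambda_i=\sigma_i$ and $w_i=v_i$ for all $i$.
   Context: $V$ carries the Hilbert space structure with $\langle v^{(1)}\otimes\cdots\otimes v^{(d)},w^{(1)}\otimes\cdots\otimes w^{(d)}\rangle=\prod_e\langle v^{(e)},w^{(e)}\rangle$. A pure tensor in $V$ is an element of the form $v^{(1)}\otimes\cdots\otimes v^{(d)}$ with $v^{(e)}\in V^{(e)}$. For an $r$-tuple $\mathbf{S}=(S_1,\dots,S_r)$ of tensors in $V$ and $\alpha>0$, $[\mathbf{S}]_\alpha$ is the maximum of $\big(\sum_{i=1}^r|\langle S_i,u\rangle|^\alpha\big)^{1/\alpha}$ over all pure tensors $u\in V$ of unit length. For real $t\geq 1$, an $r$-tuple $\mathbf{S}$ of tensors of unit length is called $t$-orthogonal if $[\mathbf{S}]_{2/t}=1$. A diagonal singular value decomposition of $T$ is a decomposition $T=\sum_{i=1}^r\sigma_iv_i$ where $\sigma_1\geq\sigma_2\geq\cdots\geq\sigma_r>0$ are real and $(v_1,\dots,v_r)$ is a $2$-orthogonal $r$-tuple of pure tensors of unit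 length; $\sigma_1,\dots,\sigma_r$ are called its singular values. *)

theory Defs
  imports "Jordan_Normal_Form.VS_Connect" "HOL-Library.FuncSet" Complex_Main
begin

record 'a cinner_space = "(complex, 'a) module" +
  cinner :: "'a \<Rightarrow> 'a \<Rightarrow> complex"

definition cnrm :: "'a cinner_space \<Rightarrow> 'a \<Rightarrow> real" where
  "cnrm V x = sqrt (Re (cinner V x x))"

text \<open>A finite dimensional complex inner product space is automatically complete, so no
  completeness axiom appears. The inner product is linear in its first argument.\<close>

locale fd_hilbert_space = vectorspace "class_ring :: complex ring" V
  for V :: "'a cinner_space" (structure) +
  assumes finite_dimensional: "fin_dim"
    and cinner_add_left: "\<lbrakk>x \<in> carrier V; y \<in> carrier V; z \<in> carrier V\<rbrakk>
      \<Longrightarrow> cinner V (x \<oplus>\<^bsub>V\<^esub> y) z = cinner V x z + cinner V y z"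
    and cinner_smult_left: "\<lbrakk>x \<in> carrier V; z \<in> carrier V\<rbrakk>
      \<Longrightarrow> cinner V (c \<odot>\<^bsub>V\<^esub> x) z = c * cinner V x z"
    and cinner_commute: "\<lbrakk>x \<in> carrier V; y \<in> carrier V\<rbrakk>
      \<Longrightarrow> cinner V y x = cnj (cinner V x y)"
    and cinner_nonneg: "x \<in> carrier V \<Longrightarrow> 0 \<le> Re (cinner V x x)"
    and cinner_definite: "\<lbrakk>x \<in> carrier V; cinner V x x = 0\<rbrakk> \<Longrightarrow> x = \<zero>\<^bsub>V\<^esub>"

definition pure_tensors ::
  "nat \<Rightarrow> (nat \<Rightarrow> 'a cinner_space) \<Rightarrow> ((nat \<Rightarrow> 'a) \<Rightarrow> 'b) \<Rightarrow> 'b set" where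
  "pure_tensors d H \<tau> = \<tau> ` (\<Pi>\<^sub>E e\<in>{1..d}. carrier (H e))"

text \<open>
  \<open>V\<close>, with the map \<open>\<tau>\<close> sending \<open>(v\<^sup>1, \<dots>, v\<^sup>d)\<close> to \<open>v\<^sup>1 \<otimes> \<cdots> \<otimes> v\<^sup>d\<close>, is a tensor product of the
  Hilbert spaces \<open>H 1, \<dots>, H d\<close>: \<open>\<tau>\<close> is multilinear, the inner product of two pure tensors is the
  product of the inner products, and the pure tensors span. Products of orthonormal bases are then
  orthonormal bases of \<open>V\<close>, so multilinear maps factor uniquely through \<open>\<tau>\<close>, and \<open>(V, \<tau>)\<close> is
  determined up to a unique isometry.  The factors have a common element type, but each has its own
  carrier, operations and dimension.
\<close>

locale hilbert_tensor_product =
  fixes d :: nat and H :: "nat \<Rightarrow> 'a cinner_space"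
    and V :: "'b cinner_space" and \<tau> :: "(nat \<Rightarrow> 'a) \<Rightarrow> 'b"
  assumes factors: "e \<in> {1..d} \<Longrightarrow> fd_hilbert_space (H e)"
    and product: "fd_hilbert_space V"
    and multilinear: "\<lbrakk>v \<in> (\<Pi>\<^sub>E e\<in>{1..d}. carrier (H e)); e \<in> {1..d}\<rbrakk>
      \<Longrightarrow> linear_map (class_ring :: complex ring) (H e) V (\<lambda>x. \<tau> (v(e := x)))"
    and cinner_pure: "\<lbrakk>v \<in> (\<Pi>\<^sub>E e\<in>{1..d}. carrier (H e)); w \<in> (\<Pi>\<^sub>E e\<in>{1..d}. carrier (H e))\<rbrakk>
      \<Longrightarrow> cinner V (\<tau> v) (\<tau> w) = (\<Prod>e\<in>{1..d}. cinner (H e) (v e) (w e))"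
    and pure_in_carrier: "pure_tensors d H \<tau> \<subseteq> carrier V"
    and pure_spans: "LinearCombinations.module.span (class_ring :: complex ring) V
      (pure_tensors d H \<tau>) = carrier V"

text \<open>
  An \<open>r\<close>-tuple is a function on indices, of which only the values at \<open>1, \<dots>, r\<close> matter.
  In the following, \<open>P\<close> is the set of pure tensors of \<open>V\<close>.  The supremum is a maximum, because
  the pure tensors of unit length form a compact set.
\<close>

definition tuple_norm ::
  "'b cinner_space \<Rightarrow> 'b set \<Rightarrow> real \<Rightarrow> nat \<Rightarrow> (nat \<Rightarrow> 'b) \<Rightarrow> real" where
  "tuple_norm V P \<alpha> r S =
    (SUP u\<in>{u \<in> P. cnrm V u = 1}. (\<Sum>i=1..r. cmod (cinner V (S i) u) powr \<alpha>) powr (1 / \<alpha>))"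

definition t_orthogonal ::
  "'b cinner_space \<Rightarrow> 'b set \<Rightarrow> real \<Rightarrow> nat \<Rightarrow> (nat \<Rightarrow> 'b) \<Rightarrow> bool" where
  "t_orthogonal V P t r S \<longleftrightarrow>
    1 \<le> t \<and> (\<forall>i\<in>{1..r}. S i \<in> carrier V \<and> cnrm V (S i) = 1) \<and> tuple_norm V P (2 / t) r S = 1"

definition diagonal_SVD ::
  "'b cinner_space \<Rightarrow> 'b set \<Rightarrow> 'b \<Rightarrow> nat \<Rightarrow> (nat \<Rightarrow> real) \<Rightarrow> (nat \<Rightarrow> 'b) \<Rightarrow> bool" where
  "diagonal_SVD V P T r \<sigma> v \<longleftrightarrow>
    (\<forall>i\<in>{1..r}. 0 < \<sigma> i) \<and>
    (\<forall>i\<in>{1..r}. \<forall>j\<in>{1..r}. i \<le> j \<longrightarrow> \<sigma> j \<le> \<sigma> i) \<and>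
    (\<forall>i\<in>{1..r}. v i \<in> P) \<and>
    t_orthogonal V P 2 r v \<and>
    T = (\<Oplus>\<^bsub>V\<^esub>i\<in>{1..r}. complex_of_real (\<sigma> i) \<odot>\<^bsub>V\<^esub> v i)"

end

theory Submission
  imports Defs
begin

text \<open>
  Testing the condition \<open>[v]\<^sub>1 = 1\<close> at \<open>u = v\<^sub>k\<close> shows that a \<open>2\<close>-orthogonal tuple of pure tensors is
  orthonormal. Hence, over unit pure tensors \<open>u\<close>, the tail \<open>\<Sum>i\<ge>k. \<sigma>\<^sub>i \<langle>v\<^sub>i, u\<rangle>\<close> is at most
  \<open>\<sigma>\<^sub>k \<Sum>i. \<bar>\<langle>v\<^sub>i, u\<rangle>\<bar> \<le> \<sigma>\<^sub>k\<close>, with equality at \<open>u = v\<^sub>k\<close>, and only there if \<open>\<sigma>\<^sub>i < \<sigma>\<^sub>k\<close> for all \<open>i > k\<close>.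
  If two decompositions agree before \<open>k\<close>, their tails from \<open>k\<close> on have equal inner products
  with every \<open>u\<close>, so they have the same maximum, and the strict one determines the maximizer.
  The argument only uses that the pure tensors form a set of vectors in \<open>V\<close>.
\<close>

context fd_hilbert_space
begin

section \<open>Inner product algebra and Cauchy-Schwarz for unit vectors\<close>

lemma smult_carrier [simp]: "x \<in> carrier V \<Longrightarrow> c \<odot>\<^bsub>V\<^esub> x \<in> carrier V"
  using smult_closed[of c x] by (simp add: class_ring_simps)

lemma cinner_zero_left:
  assumes "x \<in> carrier V"
  shows "cinner V \<zero>\<^bsub>V\<^esub> x = 0"
  using cinner_add_left[of "\<zero>\<^bsub>V\<^esub>" "\<zero>\<^bsub>V\<^esub>" x] assms by simp

lemma cinner_minus_left:
  assumes "x \<in> carrier V" "y \<in> carrier V"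
  shows "cinner V (\<ominus>\<^bsub>V\<^esub> x) y = - cinner V x y"
proof -
  have "cinner V (x \<oplus>\<^bsub>V\<^esub> \<ominus>\<^bsub>V\<^esub> x) y = cinner V x y + cinner V (\<ominus>\<^bsub>V\<^esub> x) y"
    using assms by (intro cinner_add_left) auto
  moreover have "x \<oplus>\<^bsub>V\<^esub> \<ominus>\<^bsub>V\<^esub> x = \<zero>\<^bsub>V\<^esub>"
    using assms by (simp add: M.r_neg)
  ultimately show ?thesis
    using assms cinner_zero_left by (simp add: add_eq_0_iff)
qed

lemma cinner_add_right:
  assumes "x \<in> carrier V" "y \<in> carrier V" "z \<in> carrier V"
  shows "cinner V x (y \<oplus>\<^bsub>V\<^esub> z) = cinner V x y + cinner V x z"
  using assms cinner_commute[of "y \<oplus>\<^bsub>V\<^esub> z" x] cinner_commute[of y x] cinner_commute[of z x]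
  by (simp add: cinner_add_left)

lemma cinner_smult_right:
  assumes "x \<in> carrier V" "y \<in> carrier V"
  shows "cinner V x (c \<odot>\<^bsub>V\<^esub> y) = cnj c * cinner V x y"
  using assms cinner_commute[of "c \<odot>\<^bsub>V\<^esub> y" x] cinner_commute[of y x]
  by (simp add: cinner_smult_left)

lemma cinner_minus_right:
  assumes "x \<in> carrier V" "y \<in> carrier V"
  shows "cinner V x (\<ominus>\<^bsub>V\<^esub> y) = - cinner V x y"
  using assms cinner_commute[of "\<ominus>\<^bsub>V\<^esub> y" x] cinner_commute[of y x]
  by (simp add: cinner_minus_left)

lemma cinner_finsum_left:
  assumes "finite I" "\<And>i. i \<in> I \<Longrightarrow> f i \<in> carrier V" "x \<in> carrier V"
  shows "cinner V (\<Oplus>\<^bsub>V\<^esub>i\<in>I. f i) x = (\<Sum>i\<in>I. cinner V (f i) x)"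
  using assms
proof (induction I rule: finite_induct)
  case empty
  then show ?case by (simp add: cinner_zero_left)
next
  case (insert i I)
  then have "(\<Oplus>\<^bsub>V\<^esub>j\<in>insert i I. f j) = f i \<oplus>\<^bsub>V\<^esub> (\<Oplus>\<^bsub>V\<^esub>j\<in>I. f j)"
    by (intro M.finsum_insert) auto
  moreover have "(\<Oplus>\<^bsub>V\<^esub>j\<in>I. f j) \<in> carrier V"
    using insert by (intro M.finsum_closed) auto
  ultimately show ?case
    using insert by (simp add: cinner_add_left)
qed

lemma cinner_self_unit:
  assumes "x \<in> carrier V" "cnrm V x = 1"
  shows "cinner V x x = 1"
proof -
  have "Re (cinner V x x) = 1"
    using assms by (simp add: cnrm_def)
  moreover have "Im (cinner V x x) = 0"
    using cinner_commute[of x x] assms(1) by (simp add: complex_eq_iff)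
  ultimately show ?thesis by (simp add: complex_eq_iff)
qed

lemma cmod_cinner_unit_le_1:
  assumes "x \<in> carrier V" "cnrm V x = 1" "y \<in> carrier V" "cnrm V y = 1"
  shows "cmod (cinner V x y) \<le> 1"
proof -
  define c where "c = cinner V x y"
  \<comment> \<open>This is the component of \<open>x\<close> orthogonal to \<open>y\<close>; its
    squared norm is \<open>1 - |c|^2\<close>, which gives Cauchy-Schwarz for unit vectors.\<close>
  define z where "z = x \<oplus>\<^bsub>V\<^esub> (- c) \<odot>\<^bsub>V\<^esub> y"
  have "cinner V y x = cnj c"
    unfolding c_def using assms by (intro cinner_commute)
  then have "cinner V z z = 1 - c * cnj c"
    using assms cinner_self_unit[of x] cinner_self_unit[of y]
    by (simp add: z_def cinner_add_left cinner_add_right cinner_smult_left cinner_smult_right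
        c_def[symmetric] algebra_simps)
  moreover have "0 \<le> Re (cinner V z z)"
    using assms by (intro cinner_nonneg) (simp add: z_def)
  ultimately have "(cmod c)\<^sup>2 \<le> 1"
    by (simp add: complex_mult_cnj cmod_power2)
  then show ?thesis
    unfolding c_def by (simp add: power_le_one_iff abs_square_le_1)
qed

text \<open>The squared norm of \<open>x - y\<close> is \<open>1 - 1 - 1 + 1 = 0\<close>. Since the
  inner product itself is 1, and not only its modulus, no phase factor is left over.\<close>

lemma unit_eq_if_cinner_eq_1:
  assumes "x \<in> carrier V" "cnrm V x = 1" "y \<in> carrier V" "cnrm V y = 1" "cinner V x y = 1"
  shows "x = y"
proof -
  have "cinner V y x = 1"
    using cinner_commute[of x y] assms by simp
  then have "cinner V (x \<oplus>\<^bsub>V\<^esub> \<ominus>\<^bsub>V\<^esub> y) (x \<oplus>\<^bsub>V\<^esub> \<ominus>\<^bsub>V\<^esub> y) = 0"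
    using assms cinner_self_unit[of x] cinner_self_unit[of y]
    by (simp add: cinner_add_left cinner_add_right cinner_minus_left cinner_minus_right)
  then have "x \<oplus>\<^bsub>V\<^esub> \<ominus>\<^bsub>V\<^esub> y = \<zero>\<^bsub>V\<^esub>"
    using assms by (intro cinner_definite) auto
  then show ?thesis
    using assms by (metis M.minus_equality M.minus_minus M.a_inv_closed M.a_comm)
qed

section \<open>Consequences of 2-orthogonality\<close>

lemma two_orthogonal_sum_le_1:
  assumes "t_orthogonal V P 2 r v" "P \<subseteq> carrier V" "u \<in> P" "cnrm V u = 1"
  shows "(\<Sum>i=1..r. cmod (cinner V (v i) u)) \<le> 1"
proof -
  let ?U = "{u \<in> P. cnrm V u = 1}"
  let ?f = "\<lambda>u. \<Sum>i=1..r. cmod (cinner V (v i) u)"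
  \<comment> \<open>A real supremum dominates its elements only if the set is bounded above.
    Cauchy-Schwarz bounds each of the \<open>r\<close> summands by 1.\<close>
  have "bdd_above (?f ` ?U)"
  proof (rule bdd_aboveI2)
    fix x assume "x \<in> ?U"
    then have "?f x \<le> (\<Sum>i=1..r. 1)"
      using assms by (intro sum_mono cmod_cinner_unit_le_1) (auto simp: t_orthogonal_def)
    then show "?f x \<le> real r" by simp
  qed
  then have "?f u \<le> (SUP u\<in>?U. ?f u)"
    using assms by (intro cSUP_upper) auto
  \<comment> \<open>For \<open>t = 2\<close> the exponents \<open>2 / t\<close> and its inverse are
    1, so both uses of \<open>powr\<close> disappear on nonnegative numbers.\<close>
  also have "\<dots> = 1"
    using assms(1) by (simp add: t_orthogonal_def tuple_norm_def sum_nonneg)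
  finally show ?thesis .
qed

text \<open>At \<open>u = v k\<close> the summand with index \<open>k\<close> is already 1 and
  exhausts the bound, so every other summand vanishes.\<close>

lemma two_orthogonal_cinner_eq_0:
  assumes "t_orthogonal V P 2 r v" "P \<subseteq> carrier V"
    and "i \<in> {1..r}" "k \<in> {1..r}" "v k \<in> P" "i \<noteq> k"
  shows "cinner V (v i) (v k) = 0"
proof -
  have k: "cnrm V (v k) = 1" "v k \<in> carrier V"
    using assms by (auto simp: t_orthogonal_def)
  have "(\<Sum>j\<in>{i, k}. cmod (cinner V (v j) (v k))) \<le> (\<Sum>j=1..r. cmod (cinner V (v j) (v k)))"
    using assms by (intro sum_mono2) auto
  also have "\<dots> \<le> 1"
    using assms k by (intro two_orthogonal_sum_le_1)
  finally show ?thesis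
    using \<open>i \<noteq> k\<close> k by (simp add: cinner_self_unit)
qed

section \<open>Maximizing the tails of one decomposition\<close>

lemma diagonal_SVD_unit:
  assumes "diagonal_SVD V P T r \<sigma> v" "i \<in> {1..r}"
  shows "v i \<in> P" "v i \<in> carrier V" "cnrm V (v i) = 1"
  using assms by (auto simp: diagonal_SVD_def t_orthogonal_def)

lemma diagonal_SVD_pos:
  assumes "diagonal_SVD V P T r \<sigma> v" "i \<in> {1..r}"
  shows "0 < \<sigma> i"
  using assms by (simp add: diagonal_SVD_def)

lemma diagonal_SVD_cinner:
  assumes "diagonal_SVD V P T r \<sigma> v" "x \<in> carrier V"
  shows "cinner V T x = (\<Sum>i=1..r. \<sigma> i * cinner V (v i) x)"
proof -
  have "v i \<in> carrier V" if "i \<in> {1..r}" for i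
    using diagonal_SVD_unit(2)[OF assms(1) that] .
  then have "cinner V (\<Oplus>\<^bsub>V\<^esub>i\<in>{1..r}. complex_of_real (\<sigma> i) \<odot>\<^bsub>V\<^esub> v i) x
      = (\<Sum>i=1..r. \<sigma> i * cinner V (v i) x)"
    using assms(2) by (subst cinner_finsum_left) (auto intro!: sum.cong simp: cinner_smult_left)
  moreover have "T = (\<Oplus>\<^bsub>V\<^esub>i\<in>{1..r}. complex_of_real (\<sigma> i) \<odot>\<^bsub>V\<^esub> v i)"
    using assms(1) unfolding diagonal_SVD_def by blast
  ultimately show ?thesis
    by argo
qed

lemma diagonal_SVD_tail_self:
  assumes "diagonal_SVD V P T r \<sigma> v" "P \<subseteq> carrier V" "k \<in> {1..r}"
  shows "(\<Sum>i=k..r. \<sigma> i * cinner V (v i) (v k)) = \<sigma> k"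
proof -
  note vk = diagonal_SVD_unit[OF assms(1,3)]
  have orth: "t_orthogonal V P 2 r v"
    using assms(1) by (simp add: diagonal_SVD_def)
  have "(\<Sum>i=k..r. \<sigma> i * cinner V (v i) (v k))
      = (\<Sum>i=k..r. if i = k then complex_of_real (\<sigma> k) else 0)"
  proof (rule sum.cong)
    fix i assume i: "i \<in> {k..r}"
    show "\<sigma> i * cinner V (v i) (v k) = (if i = k then complex_of_real (\<sigma> k) else 0)"
    proof (cases "i = k")
      case True
      then show ?thesis
        using cinner_self_unit[OF vk(2,3)] by simp
    next
      case False
      then show ?thesis
        using two_orthogonal_cinner_eq_0[OF orth assms(2) _ assms(3) vk(1)] i assms(3) by simp
    qed
  qed simp
  then show ?thesis
    using assms(3) by simp
qed

lemma diagonal_SVD_tail_le: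
  assumes "diagonal_SVD V P T r \<sigma> v" "P \<subseteq> carrier V" "k \<in> {1..r}" "u \<in> P" "cnrm V u = 1"
  shows "(\<Sum>i=k..r. \<sigma> k * cmod (cinner V (v i) u)) \<le> \<sigma> k"
proof -
  have "(\<Sum>i=k..r. cmod (cinner V (v i) u)) \<le> (\<Sum>i=1..r. cmod (cinner V (v i) u))"
    using assms(3) by (intro sum_mono2) auto
  also have "\<dots> \<le> 1"
    using assms by (intro two_orthogonal_sum_le_1[of P]) (auto simp: diagonal_SVD_def)
  finally have "\<sigma> k * (\<Sum>i=k..r. cmod (cinner V (v i) u)) \<le> \<sigma> k * 1"
    using assms by (intro mult_left_mono) (auto simp: diagonal_SVD_pos less_imp_le)
  then show ?thesis
    by (simp add: sum_distrib_left)
qed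

text \<open>Two losses are combined here: the real part against the modulus, and \<sigma> at
  \<open>i\<close> against \<sigma> at \<open>k\<close>. Keeping the bound termwise allows the
  equality case to be analysed index by index.\<close>

lemma diagonal_SVD_tail_term_le:
  assumes "diagonal_SVD V P T r \<sigma> v" "k \<in> {1..r}" "i \<in> {k..r}"
  shows "Re (\<sigma> i * cinner V (v i) u) \<le> \<sigma> k * cmod (cinner V (v i) u)"
proof -
  have "0 < \<sigma> i" "\<sigma> i \<le> \<sigma> k"
    using assms by (auto simp: diagonal_SVD_def)
  then have "\<sigma> i * Re (cinner V (v i) u) \<le> \<sigma> i * cmod (cinner V (v i) u)"
    "\<sigma> i * cmod (cinner V (v i) u) \<le> \<sigma> k * cmod (cinner V (v i) u)"
    by (auto intro: mult_left_mono mult_right_mono complex_Re_le_cmod)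
  then show ?thesis by simp
qed

lemma diagonal_SVD_tail_Re_le:
  assumes "diagonal_SVD V P T r \<sigma> v" "P \<subseteq> carrier V" "k \<in> {1..r}" "u \<in> P" "cnrm V u = 1"
  shows "Re (\<Sum>i=k..r. \<sigma> i * cinner V (v i) u) \<le> \<sigma> k"
proof -
  have "Re (\<Sum>i=k..r. \<sigma> i * cinner V (v i) u) \<le> (\<Sum>i=k..r. \<sigma> k * cmod (cinner V (v i) u))"
    unfolding Re_sum using assms(1,3) by (intro sum_mono diagonal_SVD_tail_term_le)
  also have "\<dots> \<le> \<sigma> k"
    using assms by (rule diagonal_SVD_tail_le)
  finally show ?thesis .
qed

text \<open>At a maximizer the nonnegative termwise gaps sum to 0, so each of them is 0. For
  \<open>i > k\<close> the strict drop in \<sigma> then forces \<open>?a i = 0\<close>; what remains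
  of the tail gives \<open>?a k = 1\<close>, the equality case for unit vectors.\<close>

lemma diagonal_SVD_tail_maximizer:
  assumes svd: "diagonal_SVD V P T r \<sigma> v" and P: "P \<subseteq> carrier V" and k: "k \<in> {1..r}"
    and u: "u \<in> P" "cnrm V u = 1"
    and less: "\<And>i. i \<in> {k<..r} \<Longrightarrow> \<sigma> i < \<sigma> k"
    and max: "(\<Sum>i=k..r. \<sigma> i * cinner V (v i) u) = \<sigma> k"
  shows "u = v k"
proof -
  let ?a = "\<lambda>i. cinner V (v i) u"
  note pos = diagonal_SVD_pos[OF svd]
  have nonneg: "0 \<le> \<sigma> k * cmod (?a i) - Re (\<sigma> i * ?a i)" if "i \<in> {k..r}" for i
    using diagonal_SVD_tail_term_le[OF svd k that] by simp
  have "(\<Sum>i=k..r. \<sigma> k * cmod (?a i) - Re (\<sigma> i * ?a i))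
      = (\<Sum>i=k..r. \<sigma> k * cmod (?a i)) - Re (\<Sum>i=k..r. \<sigma> i * ?a i)"
    unfolding Re_sum by (rule sum_subtractf)
  also have "\<dots> \<le> 0"
    unfolding max using diagonal_SVD_tail_le[OF svd P k u] by simp
  finally have "(\<Sum>i=k..r. \<sigma> k * cmod (?a i) - Re (\<sigma> i * ?a i)) = 0"
    using nonneg by (intro antisym sum_nonneg) auto
  then have zero: "\<sigma> k * cmod (?a i) = Re (\<sigma> i * ?a i)" if "i \<in> {k..r}" for i
    using nonneg that by (subst (asm) sum_nonneg_eq_0_iff) auto
  have "?a i = 0" if i: "i \<in> {k<..r}" for i
  proof -
    have "\<sigma> k * cmod (?a i) \<le> \<sigma> i * cmod (?a i)"
      using zero[of i] i pos[of i] complex_Re_le_cmod[of "?a i"] by simp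
    then show ?thesis
      using less[OF i] by (auto simp: mult_le_cancel_right)
  qed
  then have "(\<Sum>i=k..r. \<sigma> i * ?a i) = \<sigma> k * ?a k"
    using k by (subst sum.atLeast_Suc_atMost) auto
  then have "?a k = 1"
    using max pos[OF k] by simp
  then show ?thesis
    using diagonal_SVD_unit[OF svd k] u P unit_eq_if_cinner_eq_1[of "v k" u] by auto
qed

section \<open>Comparing two decompositions\<close>

text \<open>Both full sums equal \<open>cinner V T x\<close>, and the terms before \<open>k\<close>
  cancel. The bounds \<open>Suc r\<close> and \<open>Suc s\<close> admit empty tails, which the
  comparison of lengths relies on.\<close>

lemma diagonal_SVD_tails_eq:
  assumes v: "diagonal_SVD V P T r \<sigma> v" and w: "diagonal_SVD V P T s \<mu> w"
    and k: "1 \<le> k" "k \<le> Suc r" "k \<le> Suc s" and x: "x \<in> carrier V"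
    and agree: "\<And>i. i \<in> {1..<k} \<Longrightarrow> \<mu> i = \<sigma> i \<and> w i = v i"
  shows "(\<Sum>i=k..r. \<sigma> i * cinner V (v i) x) = (\<Sum>i=k..s. \<mu> i * cinner V (w i) x)"
proof -
  have split: "(\<Sum>i=1..n. f i) = (\<Sum>i=1..<k. f i) + (\<Sum>i=k..n. f i)" if "k \<le> Suc n"
    for n and f :: "nat \<Rightarrow> complex"
    using sum.atLeastLessThan_concat[of 1 k "Suc n" f] k(1) that
    by (simp add: atLeastLessThanSuc_atLeastAtMost)
  have "(\<Sum>i=1..<k. \<sigma> i * cinner V (v i) x) = (\<Sum>i=1..<k. \<mu> i * cinner V (w i) x)"
    using agree by (intro sum.cong) auto
  then show ?thesis
    using diagonal_SVD_cinner[OF v x] diagonal_SVD_cinner[OF w x] split[OF k(2)] split[OF k(3)]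
    by simp
qed

text \<open>If \<open>s > r\<close>, the first tail from \<open>Suc r\<close> is empty and hence 0,
  while the second one, evaluated at \<open>w (Suc r)\<close>, is a positive singular value.\<close>

lemma diagonal_SVD_length_le:
  assumes v: "diagonal_SVD V P T r \<sigma> v" and w: "diagonal_SVD V P T s \<mu> w" and P: "P \<subseteq> carrier V"
    and agree: "\<And>i. i \<in> {1..r} \<Longrightarrow> i \<le> s \<Longrightarrow> \<mu> i = \<sigma> i \<and> w i = v i"
  shows "s \<le> r"
proof (rule ccontr)
  assume "\<not> s \<le> r"
  then have k: "Suc r \<in> {1..s}" by simp
  then have "(\<Sum>i=Suc r..r. \<sigma> i * cinner V (v i) (w (Suc r))) = \<mu> (Suc r)"
    using diagonal_SVD_tails_eq[OF v w, of "Suc r" "w (Suc r)"] diagonal_SVD_tail_self[OF w P k]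
      diagonal_SVD_unit[OF w k] agree by simp
  then have "\<mu> (Suc r) = 0" by simp
  moreover have "0 < \<mu> (Suc r)"
    using diagonal_SVD_pos[OF w k] .
  ultimately show False by simp
qed

lemma diagonal_SVD_agree:
  assumes v: "diagonal_SVD V P T r \<sigma> v" and w: "diagonal_SVD V P T s \<mu> w" and P: "P \<subseteq> carrier V"
    and less: "\<And>i j. i \<in> {1..r} \<Longrightarrow> j \<in> {1..r} \<Longrightarrow> i < j \<Longrightarrow> \<sigma> j < \<sigma> i"
    and "k \<in> {1..r}" "k \<le> s"
  shows "\<mu> k = \<sigma> k \<and> w k = v k"
  using assms(5,6)
proof (induction k rule: less_induct)
  case (less k)
  then have kr: "k \<in> {1..r}" and ks: "k \<in> {1..s}" by auto
  have tails: "(\<Sum>i=k..r. \<sigma> i * cinner V (v i) x) = (\<Sum>i=k..s. \<mu> i * cinner V (w i) x)"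
    if "x \<in> carrier V" for x
    using less kr ks that by (intro diagonal_SVD_tails_eq[OF v w]) auto
  note vk = diagonal_SVD_unit[OF v kr] and wk = diagonal_SVD_unit[OF w ks]
  \<comment> \<open>At \<open>v k\<close> the common tail takes the value \<open>\<sigma> k\<close>,
    and as a tail of the second decomposition it is at most \<open>\<mu> k\<close>. Evaluating at
    \<open>w k\<close> gives the reverse inequality.\<close>
  have "\<sigma> k \<le> \<mu> k"
    using diagonal_SVD_tail_Re_le[OF w P ks vk(1,3)]
    unfolding tails[OF vk(2), symmetric] diagonal_SVD_tail_self[OF v P kr] Re_complex_of_real .
  moreover have "\<mu> k \<le> \<sigma> k"
    using diagonal_SVD_tail_Re_le[OF v P kr wk(1,3)]
    unfolding tails[OF wk(2)] diagonal_SVD_tail_self[OF w P ks] Re_complex_of_real .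
  ultimately have eq: "\<mu> k = \<sigma> k" by simp
  \<comment> \<open>Now \<open>w k\<close> attains the maximum of the strictly decreasing tail,
    whose maximizer is unique.\<close>
  moreover have "w k = v k"
  proof (rule diagonal_SVD_tail_maximizer[OF v P kr wk(1,3)])
    show "\<sigma> i < \<sigma> k" if "i \<in> {k<..r}" for i
      using assms(4) kr that by auto
    show "(\<Sum>i=k..r. \<sigma> i * cinner V (v i) (w k)) = \<sigma> k"
      using tails[OF wk(2)] diagonal_SVD_tail_self[OF w P ks] eq by simp
  qed
  ultimately show ?case ..
qed

end

theorem theorem1p7:
  fixes d :: nat and H :: "nat \<Rightarrow> 'a cinner_space"
    and V :: "'b cinner_space" and \<tau> :: "(nat \<Rightarrow> 'a) \<Rightarrow> 'b"
    and T :: 'b and r s :: nat and \<sigma> \<mu> :: "nat \<Rightarrow> real" and v w :: "nat \<Rightarrow> 'b"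
  assumes "hilbert_tensor_product d H V \<tau>"
    and "T \<in> carrier V"
    and "diagonal_SVD V (pure_tensors d H \<tau>) T r \<sigma> v"
    and "\<forall>i\<in>{1..r}. \<forall>j\<in>{1..r}. i < j \<longrightarrow> \<sigma> j < \<sigma> i"
    and "diagonal_SVD V (pure_tensors d H \<tau>) T s \<mu> w"
  shows "s = r \<and> (\<forall>i\<in>{1..r}. \<mu> i = \<sigma> i \<and> w i = v i)"
proof -
  interpret fd_hilbert_space V
    using assms(1) by (rule hilbert_tensor_product.product)
  have P: "pure_tensors d H \<tau> \<subseteq> carrier V"
    using assms(1) by (rule hilbert_tensor_product.pure_in_carrier)
  have agree: "\<mu> k = \<sigma> k \<and> w k = v k" if "k \<in> {1..r}" "k \<le> s" for k
    using diagonal_SVD_agree[OF assms(3,5) P] assms(4) that by blast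
  \<comment> \<open>Agreement is known up to the smaller of \<open>r\<close> and \<open>s\<close>,
    so the length comparison applies with the decompositions in either order.\<close>
  have "s \<le> r"
    using diagonal_SVD_length_le[OF assms(3,5) P] agree by blast
  moreover have "r \<le> s"
    using agree by (intro diagonal_SVD_length_le[OF assms(5,3) P]) auto
  ultimately show ?thesis
    using agree by auto
qed

end
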